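(* Let $k$ be a positive integer, and let $G$ be a graph. If $\delta(G) > 2k^2-1$, then $G$ contains a $(k+1)$-connected induced subgraph $H$ such that $\partial_G(H) \subsetneq V(H)$ and $|\partial_G(H)| \leq 2k^2-1$.
   Context: All graphs are finite, simple, and non-null. $\delta(G)$ denotes the minimum degree of a vertex of $G$. A cutset of a graph $G$ is a (possibly empty) set $C \subseteq V(G)$ such that $G \smallsetminus C$ is disconnected. A graph is $k$-connected if it has at least $k+1$ vertices and has no cutset of size at most $k-1$. For an induced subgraph $H$ of $G$, the frontier $\partial_G(H)$ is the set of all vertices of $H$ that have a neighbor (in $G$) in $V(G) \smallsetminus V(H)$. *)

theory Defs
  imports "Graph_Theory.Graph_Theory"
begin

text \<open>
  Finite simple graphs are the loop-free symmetric digraphs without parallel arcs of the locale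
  \<^locale>\<open>graph\<close>: an edge is a pair of opposite arcs, so the out-degree of a vertex is its number
  of neighbours. That locale admits the null graph.
\<close>

text \<open>Meaningful for finite non-null graphs only.\<close>
definition min_degree :: "('a, 'b) pre_digraph \<Rightarrow> nat" where
  "min_degree G = Min (out_degree G ` verts G)"

text \<open>
  The library's \<^const>\<open>Digraph_Component.connected\<close> is false for the null graph. As graphs are non-null
  here, deleting all vertices does not leave a disconnected graph.
\<close>
definition disconnected :: "('a, 'b) pre_digraph \<Rightarrow> bool" where
  "disconnected G \<longleftrightarrow> verts G \<noteq> {} \<and> \<not> Digraph_Component.connected G"

definition cutset :: "('a, 'b) pre_digraph \<Rightarrow> 'a set \<Rightarrow> bool" where
  "cutset G C \<longleftrightarrow> C \<subseteq> verts G \<and> disconnected (G \<restriction> (verts G - C))"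

text \<open>The size bound is strict to avoid truncated subtraction in \<open>k - 1\<close>.\<close>
definition k_connected :: "nat \<Rightarrow> ('a, 'b) pre_digraph \<Rightarrow> bool" where
  "k_connected k G \<longleftrightarrow> k + 1 \<le> card (verts G) \<and> \<not> (\<exists>C. cutset G C \<and> card C < k)"

definition frontier :: "('a, 'b) pre_digraph \<Rightarrow> ('a, 'b) pre_digraph \<Rightarrow> 'a set" where
  "frontier G H = {v \<in> verts H. \<exists>u \<in> verts G - verts H. v \<rightarrow>\<^bsub>G\<^esub> u}"

end

theory Submission
  imports Defs
begin

text \<open>
  The frontier of a set \<open>X\<close> of vertices is measured by a weight: a vertex \<open>v\<close> of \<open>X\<close> weighs
  \<open>min k d\<close>, where \<open>d\<close> is the number of its neighbours outside \<open>X\<close>. The frontier vertices are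
  the vertices of positive weight, so the total weight bounds the size of the frontier. Among the
  sets of total weight less than \<open>2k\<^sup>2\<close> that have a vertex outside their frontier (the whole
  vertex set is one), an inclusion-minimal \<open>X\<close> induces the required subgraph.

  It has more than \<open>2k\<^sup>2\<close> vertices, because it contains a vertex together with all its neighbours.
  Suppose that a set \<open>C\<close> of at most \<open>k\<close> vertices separates \<open>X - C\<close> into \<open>A\<close> and \<open>B\<close>. One side,
  say \<open>A\<close>, weighs less than \<open>k\<^sup>2\<close>. The vertices of \<open>A\<close> have the same weight in \<open>A \<union> C\<close> as in \<open>X\<close>,
  and \<open>C\<close> weighs at most \<open>k \<cdot> k\<close> in any set, so \<open>A \<union> C\<close> still weighs less than \<open>2k\<^sup>2\<close>. By
  minimality all of its vertices lie in its frontier. Then each vertex of \<open>A\<close> has positive weight, so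
  \<open>A\<close> has fewer than \<open>k\<^sup>2\<close> vertices, and the degree condition gives every vertex of \<open>A\<close> at
  least \<open>k\<close> neighbours outside \<open>X\<close>, that is, the full weight \<open>k\<close>. Deleting \<open>A\<close> from \<open>X\<close> therefore
  removes weight \<open>k|A|\<close>, while each of the at most \<open>k\<close> vertices of \<open>C\<close> gains at most \<open>|A|\<close>. So
  \<open>B \<union> C\<close> is no heavier than \<open>X\<close>. It is not all frontier either: otherwise every vertex of \<open>B\<close>
  would have positive weight in \<open>X\<close>, so that \<open>k|A| + |B| < 2k\<^sup>2\<close>, whereas
  \<open>|A| + |B| \<ge> |X| - k > 2k\<^sup>2 - k\<close>; together these give \<open>(k - 1)(|A| - 1) < 0\<close>. This contradicts the
  minimality of \<open>X\<close>.
\<close>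

section \<open>Neighbourhoods and separations\<close>

context graph
begin

definition nbrs :: "'a \<Rightarrow> 'a set" where
  "nbrs v = {u. v \<rightarrow> u}"

lemma nbrs_subset: "nbrs v \<subseteq> verts G"
  by (auto simp: nbrs_def)

lemma finite_nbrs: "finite (nbrs v)"
  using nbrs_subset finite_verts by (rule finite_subset)

lemma not_self_nbr: "v \<notin> nbrs v"
  using adj_not_same by (auto simp: nbrs_def)

lemma card_nbrs: "card (nbrs v) = out_degree G v"
proof -
  have "nbrs v = head G ` out_arcs G v"
    by (force simp: nbrs_def arcs_ends_conv out_arcs_def)
  moreover have "inj_on (head G) (out_arcs G v)"
    by (rule inj_onI) (auto simp: out_arcs_def arc_to_ends_def intro!: no_multi_arcs)
  ultimately show ?thesis
    by (simp add: out_degree_def card_image)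
qed

lemma min_degree_le_card_nbrs:
  assumes "v \<in> verts G"
  shows "min_degree G \<le> card (nbrs v)"
  using assms by (simp add: card_nbrs min_degree_def)

definition separates :: "'a set \<Rightarrow> 'a set \<Rightarrow> 'a set \<Rightarrow> 'a set \<Rightarrow> bool" where
  "separates C X A B \<longleftrightarrow> C \<subseteq> X \<and> X - C = A \<union> B \<and> A \<inter> B = {} \<and> A \<noteq> {} \<and> B \<noteq> {} \<and>
     (\<forall>a\<in>A. \<forall>b\<in>B. a \<notin> nbrs b \<and> b \<notin> nbrs a)"

lemma separates_commute: "separates C X A B \<Longrightarrow> separates C X B A"
  by (auto simp: separates_def)

text \<open>
  One side is the set of vertices reachable from some vertex \<open>u\<close>, in a pair \<open>u\<close>, \<open>v\<close> that
  witnesses disconnectedness.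
\<close>
lemma cutset_imp_separates:
  assumes "cutset (G \<restriction> X) C"
  obtains A B where "separates C X A B"
proof -
  let ?D = "G \<restriction> (X - C)"
  let ?R = "rtrancl_on (X - C) ((arcs_ends ?D)\<^sup>s)"
  have D: "(G \<restriction> X) \<restriction> (X - C) = ?D"
    by (auto simp: induce_subgraph_def)
  have CX: "C \<subseteq> X"
    using assms by (simp add: cutset_def)
  have "disconnected ?D"
    using assms by (simp add: cutset_def D)
  then obtain u v where uv: "u \<in> X - C" "v \<in> X - C" "(u, v) \<notin> ?R"
    by (auto simp: disconnected_def connected_conv)
  define A where "A = {w \<in> X - C. (u, w) \<in> ?R}"
  define B where "B = X - C - A"
  have "u \<in> A" "v \<in> B"
    using uv by (auto simp: A_def B_def)
  moreover have "a \<notin> nbrs b \<and> b \<notin> nbrs a" if "a \<in> A" "b \<in> B" for a b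
  proof (rule ccontr)
    assume "\<not> (a \<notin> nbrs b \<and> b \<notin> nbrs a)"
    with that have "(a, b) \<in> (arcs_ends ?D)\<^sup>s"
      by (fastforce simp: nbrs_def A_def B_def arcs_ends_conv symcl_def)
    with that have "(u, b) \<in> ?R"
      by (auto simp: A_def B_def intro: rtrancl_on_into_rtrancl_on)
    with that show False
      by (auto simp: A_def B_def)
  qed
  ultimately have "separates C X A B"
    using CX by (auto simp: separates_def A_def B_def)
  then show thesis ..
qed

section \<open>The weight of the frontier\<close>

text \<open>
  The cap \<open>k\<close> is a compromise: it is low enough that a separator of \<open>k\<close> vertices weighs at most
  \<open>k\<^sup>2\<close>, and high enough that the weight of a deleted vertex can pay for the unit increase of each
  vertex of such a separator.
\<close>
definition frontier_weight :: "nat \<Rightarrow> 'a set \<Rightarrow> 'a \<Rightarrow> nat" where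
  "frontier_weight k X v = min k (card (nbrs v - X))"

definition interior_vertices :: "'a set \<Rightarrow> 'a set" where
  "interior_vertices X = {v \<in> X. nbrs v \<subseteq> X}"

definition light :: "nat \<Rightarrow> 'a set \<Rightarrow> bool" where
  "light k X \<longleftrightarrow> X \<subseteq> verts G \<and> interior_vertices X \<noteq> {} \<and>
     (\<Sum>v\<in>X. frontier_weight k X v) < 2 * k\<^sup>2"

lemma frontier_weight_le: "frontier_weight k X v \<le> k"
  by (simp add: frontier_weight_def)

lemma frontier_weight_pos:
  assumes "k > 0" "v \<in> X" "v \<notin> interior_vertices X"
  shows "1 \<le> frontier_weight k X v"
proof -
  have "nbrs v - X \<noteq> {}"
    using assms by (auto simp: interior_vertices_def)
  then have "card (nbrs v - X) > 0"
    by (simp add: card_gt_0_iff finite_nbrs)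
  then show ?thesis
    using assms(1) by (simp add: frontier_weight_def)
qed

lemma card_le_sum_frontier_weight:
  assumes "k > 0" "S \<subseteq> X" "S \<inter> interior_vertices X = {}"
  shows "card S \<le> (\<Sum>v\<in>S. frontier_weight k X v)"
proof -
  have "(\<Sum>v\<in>S. 1) \<le> (\<Sum>v\<in>S. frontier_weight k X v)"
    using assms by (intro sum_mono frontier_weight_pos) auto
  then show ?thesis by simp
qed

lemma sum_frontier_weight_le:
  assumes "card C \<le> k"
  shows "(\<Sum>v\<in>C. frontier_weight k X v) \<le> k\<^sup>2"
proof -
  have "(\<Sum>v\<in>C. frontier_weight k X v) \<le> card C * k"
    using sum_bounded_above[of C "frontier_weight k X" k] frontier_weight_le by simp
  also have "\<dots> \<le> k\<^sup>2"
    using assms by (simp add: power2_eq_square)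
  finally show ?thesis .
qed

lemma frontier_weight_side:
  assumes "separates C X A B" "v \<in> A"
  shows "frontier_weight k (A \<union> C) v = frontier_weight k X v"
proof -
  have "nbrs v - (A \<union> C) = nbrs v - X"
    using assms by (auto simp: separates_def)
  then show ?thesis by (simp add: frontier_weight_def)
qed

lemma frontier_weight_delete:
  assumes "finite A"
  shows "frontier_weight k (X - A) v \<le> frontier_weight k X v + card A"
proof -
  have "card (nbrs v - (X - A)) \<le> card ((nbrs v - X) \<union> A)"
    using assms by (intro card_mono) (auto simp: finite_nbrs)
  also have "\<dots> \<le> card (nbrs v - X) + card A"
    by (rule card_Un_le)
  finally show ?thesis by (simp add: frontier_weight_def)
qed

lemma card_gt_if_interior:
  assumes "\<And>v. v \<in> verts G \<Longrightarrow> d \<le> card (nbrs v)"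
    and "X \<subseteq> verts G" "interior_vertices X \<noteq> {}"
  shows "d < card X"
proof -
  obtain v where v: "v \<in> X" "nbrs v \<subseteq> X"
    using assms(3) by (auto simp: interior_vertices_def)
  have "finite X"
    using assms(2) finite_verts by (rule finite_subset)
  moreover have "nbrs v \<subset> X"
    using v not_self_nbr by blast
  ultimately have "card (nbrs v) < card X"
    by (rule psubset_card_mono)
  then show ?thesis
    using assms(1)[of v] assms(2) v by fastforce
qed

section \<open>Shrinking a light set along a small separator\<close>

text \<open>
  The two candidates are \<open>A \<union> C\<close> and \<open>B \<union> C\<close>: the first is always light enough, and
  when it has no interior vertex, the vertices of \<open>A\<close> have so few neighbours in \<open>X\<close> that discarding
  them does not increase the weight.
\<close>
lemma light_side_gives_smaller:
  assumes k: "k > 0"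
    and deg: "\<And>v. v \<in> verts G \<Longrightarrow> 2 * k\<^sup>2 \<le> card (nbrs v)"
    and X: "light k X"
    and sep: "separates C X A B" and C: "card C \<le> k"
    and side: "(\<Sum>v\<in>A. frontier_weight k X v) < k\<^sup>2"
  obtains Y where "Y \<subset> X" "light k Y"
proof (cases "interior_vertices (A \<union> C) = {}")
  case False
  have XV: "X \<subseteq> verts G"
    using X by (simp add: light_def)
  have ACX: "A \<union> C \<subset> X" and AC: "A \<inter> C = {}"
    using sep by (auto simp: separates_def)
  then have fin: "finite A" "finite C"
    using XV finite_verts by (meson finite_subset le_sup_iff psubset_imp_subset)+
  have "(\<Sum>v\<in>A \<union> C. frontier_weight k (A \<union> C) v)
      = (\<Sum>v\<in>A. frontier_weight k (A \<union> C) v) + (\<Sum>v\<in>C. frontier_weight k (A \<union> C) v)"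
    using fin AC by (rule sum.union_disjoint)
  also have "(\<Sum>v\<in>A. frontier_weight k (A \<union> C) v) = (\<Sum>v\<in>A. frontier_weight k X v)"
    using frontier_weight_side[OF sep] by simp
  also have "\<dots> + (\<Sum>v\<in>C. frontier_weight k (A \<union> C) v) < 2 * k\<^sup>2"
    using side sum_frontier_weight_le[OF C, of "A \<union> C"] by linarith
  finally have "light k (A \<union> C)"
    using False ACX XV by (auto simp: light_def)
  with ACX show thesis by (rule that)
next
  case True
  have XV: "X \<subseteq> verts G" and X_int: "interior_vertices X \<noteq> {}"
    and X_wt: "(\<Sum>v\<in>X. frontier_weight k X v) < 2 * k\<^sup>2"
    using X by (auto simp: light_def)
  have finX: "finite X"
    using XV finite_verts by (rule finite_subset)
  have X_eq: "X = A \<union> (B \<union> C)" "A \<inter> (B \<union> C) = {}" "B \<inter> C = {}" and ne: "A \<noteq> {}"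
    and BC: "B \<union> C = X - A"
    using sep by (auto simp: separates_def)
  have fin: "finite A" "finite B" "finite C"
    using finX X_eq(1) by auto
  have nbrs_A: "nbrs v \<inter> X \<subseteq> (A - {v}) \<union> C" if "v \<in> A" for v
    using sep that not_self_nbr by (auto simp: separates_def)
  have A_int: "A \<inter> interior_vertices X = {}"
    using True nbrs_A by (fastforce simp: interior_vertices_def)
  have cardA: "card A < k\<^sup>2"
    using card_le_sum_frontier_weight[OF k _ A_int] X_eq(1) side by fastforce
  have A_wt: "frontier_weight k X v = k" if "v \<in> A" for v
  proof -
    have "card (nbrs v \<inter> X) \<le> card ((A - {v}) \<union> C)"
      using fin nbrs_A[OF that] by (intro card_mono) auto
    also have "\<dots> \<le> card (A - {v}) + card C"
      by (rule card_Un_le)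
    finally have "card (nbrs v \<inter> X) < card A + k"
      using C card_Diff1_less[OF fin(1) that] by linarith
    moreover have "card (nbrs v) = card (nbrs v \<inter> X) + card (nbrs v - X)"
      using finite_nbrs by (simp add: card_Int_Diff)
    moreover have "2 * k\<^sup>2 \<le> card (nbrs v)"
      using deg that XV X_eq(1) by blast
    \<comment> \<open>So \<open>v\<close> has at least \<open>k\<^sup>2 - k + 2\<close> neighbours outside \<open>X\<close>; this is at least \<open>k\<close> as \<open>(k - 1)\<^sup>2 \<ge> 0\<close>.\<close>
    moreover have "2 * k \<le> k\<^sup>2 + 1"
      using k by (cases k) (auto simp: power2_eq_square)
    ultimately have "k \<le> card (nbrs v - X)"
      using cardA by linarith
    then show ?thesis by (simp add: frontier_weight_def)
  qed
  have split: "sum f X = sum f A + sum f B + sum f C" for f :: "'a \<Rightarrow> nat"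
    using fin X_eq by (simp add: sum.union_disjoint)
  have X_split: "(\<Sum>v\<in>X. frontier_weight k X v)
      = card A * k + (\<Sum>v\<in>B. frontier_weight k X v) + (\<Sum>v\<in>C. frontier_weight k X v)"
    unfolding split using A_wt by simp
  have "(\<Sum>v\<in>B \<union> C. frontier_weight k (B \<union> C) v)
      = (\<Sum>v\<in>B. frontier_weight k (B \<union> C) v) + (\<Sum>v\<in>C. frontier_weight k (B \<union> C) v)"
    using fin X_eq(3) by (simp add: sum.union_disjoint)
  also have "(\<Sum>v\<in>B. frontier_weight k (B \<union> C) v) = (\<Sum>v\<in>B. frontier_weight k X v)"
    using frontier_weight_side[OF separates_commute[OF sep]] by simp
  also have "(\<Sum>v\<in>C. frontier_weight k (B \<union> C) v) \<le> (\<Sum>v\<in>C. frontier_weight k X v + card A)"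
    unfolding BC using fin(1) by (intro sum_mono frontier_weight_delete)
  also have "\<dots> = (\<Sum>v\<in>C. frontier_weight k X v) + card C * card A"
    by (simp add: sum.distrib)
  also have "card C * card A \<le> card A * k"
    using C by (simp add: mult.commute)
  finally have BC_wt: "(\<Sum>v\<in>B \<union> C. frontier_weight k (B \<union> C) v) < 2 * k\<^sup>2"
    using X_wt X_split by linarith
  have "interior_vertices (B \<union> C) \<noteq> {}"
  proof
    assume none: "interior_vertices (B \<union> C) = {}"
    have B_int: "B \<inter> interior_vertices X = {}"
    proof (rule ccontr)
      assume "B \<inter> interior_vertices X \<noteq> {}"
      then obtain b where b: "b \<in> B" "nbrs b \<subseteq> X"
        by (auto simp: interior_vertices_def)
      moreover have "nbrs b \<inter> A = {}"
        using sep b(1) unfolding separates_def by blast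
      ultimately have "nbrs b \<subseteq> B \<union> C"
        using BC by blast
      then show False
        using b(1) none by (auto simp: interior_vertices_def)
    qed
    have "card B \<le> (\<Sum>v\<in>B. frontier_weight k X v)"
      using card_le_sum_frontier_weight[OF k _ B_int] X_eq(1) by blast
    then have upper: "card A * k + card B < 2 * k\<^sup>2"
      using X_wt X_split by linarith
    have "2 * k\<^sup>2 < card X"
      using deg XV X_int by (rule card_gt_if_interior)
    also have "card X \<le> card A + card B + k"
      using card_Un_le[of A "B \<union> C"] card_Un_le[of B C] C X_eq(1) by simp
    finally have "card A * k + 1 < card A + k"
      using upper by linarith
    \<comment> \<open>This says \<open>(|A| - 1) (k - 1) < 0\<close>.\<close>
    moreover obtain a j where "card A = Suc a" "k = Suc j"
      using k ne fin(1) by (metis card_gt_0_iff gr0_conv_Suc)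
    ultimately show False by simp
  qed
  with BC_wt XV X_eq(1) have "light k (B \<union> C)"
    by (simp add: light_def)
  moreover have "B \<union> C \<subset> X"
    using X_eq(1,2) ne by blast
  ultimately show thesis by (intro that)
qed

lemma separated_light_not_minimal:
  assumes k: "k > 0"
    and deg: "\<And>v. v \<in> verts G \<Longrightarrow> 2 * k\<^sup>2 \<le> card (nbrs v)"
    and X: "light k X"
    and sep: "separates C X A B" and C: "card C \<le> k"
  obtains Y where "Y \<subset> X" "light k Y"
proof -
  have "X \<subseteq> verts G"
    using X by (simp add: light_def)
  then have finX: "finite X"
    using finite_verts by (rule finite_subset)
  have AB: "A \<union> B \<subseteq> X" "A \<inter> B = {}"
    using sep by (auto simp: separates_def)
  then have fin: "finite A" "finite B"
    using finX by (auto intro: finite_subset)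
  have "(\<Sum>v\<in>A. frontier_weight k X v) + (\<Sum>v\<in>B. frontier_weight k X v)
      = (\<Sum>v\<in>A \<union> B. frontier_weight k X v)"
    using fin AB(2) by (simp add: sum.union_disjoint)
  also have "\<dots> \<le> (\<Sum>v\<in>X. frontier_weight k X v)"
    using finX AB(1) by (intro sum_mono2) auto
  also have "\<dots> < 2 * k\<^sup>2"
    using X by (simp add: light_def)
  finally consider "(\<Sum>v\<in>A. frontier_weight k X v) < k\<^sup>2" | "(\<Sum>v\<in>B. frontier_weight k X v) < k\<^sup>2"
    by linarith
  then show thesis
    using light_side_gives_smaller[OF k deg X sep C]
      light_side_gives_smaller[OF k deg X separates_commute[OF sep] C] that
    by cases blast+
qed

lemma frontier_induce_subgraph:
  assumes "X \<subseteq> verts G"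
  shows "frontier G (G \<restriction> X) = X - interior_vertices X"
  using assms nbrs_subset by (fastforce simp: frontier_def interior_vertices_def nbrs_def)

end

section \<open>Highly connected subgraphs with small frontier\<close>

theorem theorem2p1:
  fixes G :: "('a, 'b) pre_digraph" and k :: nat
  assumes "k > 0"
    and "graph G" and "verts G \<noteq> {}"
    and "min_degree G > 2 * k\<^sup>2 - 1"
  shows "\<exists>H. induced_subgraph H G \<and> k_connected (k + 1) H \<and>
           frontier G H \<subset> verts H \<and> card (frontier G H) \<le> 2 * k\<^sup>2 - 1"
proof -
  interpret graph G by fact
  have k2: "0 < k\<^sup>2"
    using \<open>k > 0\<close> by simp
  have deg: "2 * k\<^sup>2 \<le> card (nbrs v)" if "v \<in> verts G" for v
    using assms(4) min_degree_le_card_nbrs[OF that] by linarith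
  have "nbrs v - verts G = {}" for v
    using nbrs_subset by blast
  then have "frontier_weight k (verts G) v = 0" for v
    unfolding frontier_weight_def by (metis card.empty min_0R)
  then have "light k (verts G)"
    using assms(3) nbrs_subset k2 by (simp add: light_def interior_vertices_def)
  moreover have "finite {X. light k X}"
    by (rule finite_subset[of _ "Pow (verts G)"]) (auto simp: light_def)
  ultimately obtain X where X: "light k X" and minimal: "\<And>Y. Y \<subset> X \<Longrightarrow> \<not> light k Y"
    using finite_has_minimal[of "{X. light k X}"] by fastforce
  let ?H = "G \<restriction> X"
  have XV: "X \<subseteq> verts G" and X_int: "interior_vertices X \<noteq> {}"
    and X_wt: "(\<Sum>v\<in>X. frontier_weight k X v) < 2 * k\<^sup>2"
    using X by (auto simp: light_def)
  have finX: "finite X"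
    using XV finite_verts by (rule finite_subset)
  have fr: "frontier G ?H = X - interior_vertices X"
    using XV by (rule frontier_induce_subgraph)
  have "induced_subgraph ?H G"
    using XV by (rule induced_induce)
  moreover have "k_connected (k + 1) ?H"
    unfolding k_connected_def
  proof (intro conjI notI)
    have "2 * k\<^sup>2 < card X"
      using deg XV X_int by (rule card_gt_if_interior)
    moreover have "k \<le> k\<^sup>2"
      by (simp add: power2_eq_square)
    ultimately show "k + 1 + 1 \<le> card (verts ?H)"
      using \<open>k > 0\<close> by simp
  next
    assume "\<exists>C. cutset ?H C \<and> card C < k + 1"
    then obtain C A B where "separates C X A B" "card C \<le> k"
      by (metis cutset_imp_separates less_Suc_eq_le Suc_eq_plus1)
    then show False
      using separated_light_not_minimal[OF \<open>k > 0\<close> deg X] minimal by metis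
  qed
  moreover have "frontier G ?H \<subset> verts ?H"
    using X_int by (auto simp: fr interior_vertices_def)
  moreover have "card (frontier G ?H) \<le> 2 * k\<^sup>2 - 1"
  proof -
    have "card (frontier G ?H) \<le> (\<Sum>v\<in>X - interior_vertices X. frontier_weight k X v)"
      unfolding fr using \<open>k > 0\<close> by (intro card_le_sum_frontier_weight) auto
    also have "\<dots> \<le> (\<Sum>v\<in>X. frontier_weight k X v)"
      using finX by (intro sum_mono2) auto
    finally show ?thesis
      using X_wt by linarith
  qed
  ultimately show ?thesis by blast
qed

end
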